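(* Let $X\geq 1$ be an integer and let $t>1$ be a real number. Put $a=(tX)^{1/(t+1)}$ and $$S_t(X)=\left\{\left\lfloor \frac{X}{n^t}\right\rfloor : n\in\mathbb{Z},\ 1\le n\le X\right\}.$$ If $X=1$, then $|S_t(X)|=1$. If $X\geq 2$, then $$|S_t(X)|=\begin{cases} a+\left\lfloor \dfrac{X}{a^t}\right\rfloor & \text{if } a \text{ is an integer},\\[2mm] \lfloor a\rfloor+\left\lfloor \dfrac{X}{\lfloor a+1\rfloor^t}\right\rfloor+\varepsilon(X,t) & \text{if } a \text{ is not an integer},\end{cases}$$ where $$\varepsilon(X,t)=\begin{cases} 0 & \text{if } X\ge \left\lfloor \dfrac{X}{\lfloor a\rfloor^t}\right\rfloor \lfloor a+1\rfloor^t,\\[2mm] 1 & \text{otherwise.}\end{cases}$$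
   Context: $\lfloor x\rfloor$ denotes the greatest integer not exceeding the real number $x$, and $|S|$ denotes the number of distinct elements of a finite set $S$. *)

theory Defs
  imports Complex_Main
begin

definition floor_values :: "real \<Rightarrow> int \<Rightarrow> int set" where
  "floor_values t X = {\<lfloor>real_of_int X / real_of_int n powr t\<rfloor> | n :: int. 1 \<le> n \<and> n \<le> X}"

definition turning_point :: "real \<Rightarrow> int \<Rightarrow> real" where
  "turning_point t X = (t * real_of_int X) powr (1 / (t + 1))"

definition correction :: "real \<Rightarrow> int \<Rightarrow> int" where
  "correction t X =
     (if real_of_int X \<ge>
           real_of_int \<lfloor>real_of_int X / real_of_int \<lfloor>turning_point t X\<rfloor> powr t\<rfloor>
             * real_of_int \<lfloor>turning_point t X + 1\<rfloor> powr t
      then 0 else 1)"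

end

theory Submission
  imports Defs
begin

text \<open>
  Write \<open>f x = X / x\<^sup>t\<close>, so that \<open>floor_values t X\<close> is the set of values \<open>\<lfloor>f n\<rfloor>\<close>. The slope
  of \<open>f\<close> at \<open>x\<close> is \<open>- t X / x\<^sup>t\<^sup>+\<^sup>1\<close>, which has absolute value at least \<open>1\<close> up to the turning
  point \<open>a\<close> and at most \<open>1\<close> after it. By the mean value theorem the integer sequence
  \<open>\<lfloor>f n\<rfloor>\<close> therefore falls strictly at every step inside \<open>[1, a]\<close>, and falls by \<open>0\<close> or \<open>1\<close>
  at every step beyond \<open>a\<close>; it ends at \<open>\<lfloor>f X\<rfloor> = 0\<close> once \<open>X \<ge> 2\<close>.

  A sequence \<open>g\<close> that falls strictly up to an index \<open>M\<close> and without skipping an integer from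
  \<open>M\<close> down to \<open>0\<close> takes \<open>M + g M\<close> values: the \<open>M - 1\<close> values before \<open>M\<close>, all different and
  above \<open>g M\<close>, and the numbers \<open>0, \<dots>, g M\<close> (\<open>card_falling_then_unit_steps\<close>). It remains to
  choose \<open>M\<close>. If \<open>a\<close> is an integer, \<open>M = a\<close> works. Otherwise the step from \<open>\<lfloor>a\<rfloor>\<close> to
  \<open>\<lfloor>a\<rfloor> + 1\<close> straddles the turning point, and its size decides: if it is strict, it extends
  the strictly falling part and \<open>M = \<lfloor>a\<rfloor> + 1\<close>; if it is zero, it belongs to the second part
  and \<open>M = \<lfloor>a\<rfloor>\<close>, where \<open>\<lfloor>f M\<rfloor> = \<lfloor>f (M + 1)\<rfloor>\<close>. The term \<open>correction t X\<close> is \<open>1\<close> precisely in the first case.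
\<close>

lemma image_unit_steps:
  fixes g :: "int \<Rightarrow> int"
  assumes "M \<le> N"
    and "\<And>n. M \<le> n \<Longrightarrow> n < N \<Longrightarrow> g (n + 1) \<le> g n \<and> g n \<le> g (n + 1) + 1"
  shows "g ` {M..N} = {g N..g M}"
  using assms
proof (induction N rule: int_ge_induct)
  case base
  then show ?case by simp
next
  case (step N)
  have IH: "g ` {M..N} = {g N..g M}"
    using step.IH step.prems by simp
  have last: "g (N + 1) \<le> g N" "g N \<le> g (N + 1) + 1"
    using step.prems[of N] step.hyps by auto
  have "g N \<in> g ` {M..N}"
    using step.hyps by simp
  then have "g N \<le> g M"
    using IH by simp
  moreover have "{M..N + 1} = insert (N + 1) {M..N}"
    using step.hyps by auto
  ultimately show ?case
    using IH last by auto
qed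

lemma strict_fall:
  fixes g :: "int \<Rightarrow> int"
  assumes "\<And>n. L \<le> n \<Longrightarrow> n < M \<Longrightarrow> g (n + 1) < g n"
    and "L \<le> i" "i < j" "j \<le> M"
  shows "g j < g i"
proof -
  have "i + 1 \<le> j"
    using \<open>i < j\<close> by simp
  then show ?thesis
    using \<open>j \<le> M\<close>
  proof (induction j rule: int_ge_induct)
    case base
    then show ?case using assms(1)[of i] \<open>L \<le> i\<close> by simp
  next
    case (step j)
    then show ?case using assms(1)[of j] \<open>L \<le> i\<close> by simp
  qed
qed

text \<open>
  The index \<open>M\<close> belongs to both parts of the hypothesis but its value is counted once, with the
  block \<open>{0..g M}\<close>: this is why the count is \<open>(M - 1) + (g M + 1)\<close>.
\<close>

lemma card_falling_then_unit_steps: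
  fixes g :: "int \<Rightarrow> int"
  assumes "1 \<le> M" "M \<le> N"
    and fall: "\<And>n. 1 \<le> n \<Longrightarrow> n < M \<Longrightarrow> g (n + 1) < g n"
    and unit: "\<And>n. M \<le> n \<Longrightarrow> n < N \<Longrightarrow> g (n + 1) \<le> g n \<and> g n \<le> g (n + 1) + 1"
    and "g N = 0"
  shows "int (card (g ` {1..N})) = M + g M"
proof -
  have less: "g j < g i" if "1 \<le> i" "i < j" "j \<le> M" for i j
    using strict_fall[of 1 M g] fall that by blast
  have tail: "g ` {M..N} = {0..g M}"
    using image_unit_steps[of M N g] unit \<open>M \<le> N\<close> \<open>g N = 0\<close> by simp
  have "g M \<in> g ` {M..N}"
    using \<open>M \<le> N\<close> by simp
  then have "0 \<le> g M"
    using tail by simp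
  have "inj_on g {1..<M}"
    by (rule linorder_inj_onI) (use less in force)+
  then have head: "card (g ` {1..<M}) = nat (M - 1)"
    by (simp add: card_image)
  have "g ` {1..<M} \<inter> {0..g M} = {}"
    using less[of _ M] by fastforce
  moreover have "{1..N} = {1..<M} \<union> {M..N}"
    using assms(1,2) by auto
  ultimately have "card (g ` {1..N}) = nat (M - 1) + card {0..g M}"
    by (simp add: image_Un tail card_Un_disjoint head)
  then show ?thesis
    using \<open>0 \<le> g M\<close> \<open>1 \<le> M\<close> by simp
qed

lemma powr_quotient_drop:
  fixes c t x :: real
  assumes "0 < x"
  obtains z where "x < z" "z < x + 1"
    "c / x powr t - c / (x + 1) powr t = t * c / z powr (t + 1)"
proof -
  have "\<exists>z>x. z < x + 1 \<and>
      c * (x + 1) powr (- t) - c * x powr (- t) = (x + 1 - x) * (c * (- t * z powr (- t - 1)))"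
    by (rule MVT2) (use assms in \<open>auto intro!: derivative_eq_intros\<close>)
  then obtain z where z: "x < z" "z < x + 1"
    "c * (x + 1) powr (- t) - c * x powr (- t) = - (t * c * z powr (- (t + 1)))"
    by auto
  have "c / x powr t - c / (x + 1) powr t = t * c / z powr (t + 1)"
    using z(3) by (simp only: powr_minus divide_inverse)
  with z(1,2) show thesis by (rule that)
qed

context
  fixes X :: int and t :: real
  assumes X: "1 \<le> X" and t: "1 < t"
begin

lemma turning_point_powr: "turning_point t X powr (t + 1) = t * X"
  using X t by (simp add: turning_point_def powr_powr)

lemma turning_point_gt_1: "1 < turning_point t X"
proof -
  have "1 * 1 < t * X"
    by (rule mult_less_le_imp_less) (use X t in auto)
  then show ?thesis
    using t by (simp add: turning_point_def gr_one_powr)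
qed

text \<open>The inequality amounts to \<open>t < X\<^sup>t\<close>, and \<open>t < 2\<^sup>t\<close> because \<open>t ln 2 > ln t\<close>.\<close>

lemma turning_point_less:
  assumes "2 \<le> X"
  shows "turning_point t X < X"
proof -
  have "ln t < t * ln 2"
  proof -
    \<comment> \<open>The tangent of the logarithm at \<open>1\<close> is applied at \<open>t / 2\<close> and at \<open>1 / 2\<close>.\<close>
    have "ln (t / 2) \<le> t / 2 - 1" "ln (1 / 2 :: real) \<le> 1 / 2 - 1"
      using t by (intro ln_le_minus_one; simp)+
    then have "ln t \<le> t / 2 - 1 + ln 2" "1 / 2 \<le> ln (2 :: real)"
      using t by (simp_all add: ln_div)
    moreover have "(t - 1) * (1 / 2) \<le> (t - 1) * ln 2"
      using t calculation(2) by (intro mult_left_mono) auto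
    ultimately show ?thesis
      by (simp add: field_simps)
  qed
  then have "exp (ln t) < exp (t * ln 2)"
    by (rule exp_less_mono)
  then have "t < 2 powr t"
    using t by (simp add: powr_def)
  also have "\<dots> \<le> X powr t"
    using assms t by (intro powr_mono2) auto
  finally have "t * X < X powr (t + 1)"
    using assms by (simp add: powr_add)
  then have "turning_point t X powr (t + 1) < X powr (t + 1)"
    by (simp add: turning_point_powr)
  then show ?thesis
    using assms t turning_point_gt_1 powr_less_cancel2[of "t + 1"] by simp
qed

lemma floor_falls_before_turning_point:
  fixes n :: int
  assumes "1 \<le> n" "n + 1 \<le> turning_point t X"
  shows "\<lfloor>X / (n + 1) powr t\<rfloor> < \<lfloor>X / n powr t\<rfloor>"
proof -
  obtain z :: real where z: "n < z" "z < real_of_int n + 1"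
    "X / n powr t - X / (real_of_int n + 1) powr t = t * X / z powr (t + 1)"
    by (rule powr_quotient_drop[of "real_of_int n" X t]) (use assms(1) in simp)
  have "z powr (t + 1) \<le> t * X"
    unfolding turning_point_powr[symmetric]
    using z assms t by (intro powr_mono2) auto
  then have "1 \<le> t * X / z powr (t + 1)"
    using z(1) assms(1) by (simp add: le_divide_eq)
  then have "X / (real_of_int n + 1) powr t + 1 \<le> X / n powr t"
    using z(3) by simp
  then show ?thesis
    unfolding of_int_add of_int_1 by linarith
qed

lemma floor_unit_steps_after_turning_point:
  fixes n :: int
  assumes "turning_point t X \<le> n"
  shows "\<lfloor>X / (n + 1) powr t\<rfloor> \<le> \<lfloor>X / n powr t\<rfloor> \<and>
    \<lfloor>X / n powr t\<rfloor> \<le> \<lfloor>X / (n + 1) powr t\<rfloor> + 1"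
proof -
  have n: "0 < real_of_int n"
    using assms turning_point_gt_1 by simp
  obtain z :: real where z: "n < z" "z < real_of_int n + 1"
    "X / n powr t - X / (real_of_int n + 1) powr t = t * X / z powr (t + 1)"
    by (rule powr_quotient_drop[OF n])
  have "t * X \<le> z powr (t + 1)"
    unfolding turning_point_powr[symmetric]
    using z assms t turning_point_gt_1 by (intro powr_mono2) auto
  then have "t * X / z powr (t + 1) \<le> 1"
    using z(1) n by (simp add: divide_le_eq)
  moreover have "0 \<le> t * X / z powr (t + 1)"
    using X t by simp
  ultimately have "X / (real_of_int n + 1) powr t \<le> X / n powr t"
    "X / n powr t \<le> X / (real_of_int n + 1) powr t + 1"
    using z(3) by linarith+
  then show ?thesis
    unfolding of_int_add of_int_1 by linarith
qed

lemma floor_last_eq_0: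
  assumes "2 \<le> X"
  shows "\<lfloor>X / X powr t\<rfloor> = 0"
proof -
  have "X powr 1 < X powr t"
    using assms t by (intro powr_less_mono) auto
  then show ?thesis
    using assms by (simp add: floor_eq_iff)
qed

lemma card_floor_values:
  assumes "2 \<le> X" "1 \<le> M" "M \<le> X"
    and "\<And>n::int. 1 \<le> n \<Longrightarrow> n < M \<Longrightarrow> \<lfloor>X / (n + 1) powr t\<rfloor> < \<lfloor>X / n powr t\<rfloor>"
    and "\<And>n::int. M \<le> n \<Longrightarrow> n < X \<Longrightarrow>
      \<lfloor>X / (n + 1) powr t\<rfloor> \<le> \<lfloor>X / n powr t\<rfloor> \<and> \<lfloor>X / n powr t\<rfloor> \<le> \<lfloor>X / (n + 1) powr t\<rfloor> + 1"
  shows "int (card (floor_values t X)) = M + \<lfloor>X / M powr t\<rfloor>"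
proof -
  have "floor_values t X = (\<lambda>n::int. \<lfloor>X / n powr t\<rfloor>) ` {1..X}"
    by (auto simp: floor_values_def)
  then show ?thesis
    using card_falling_then_unit_steps[of M X "\<lambda>n::int. \<lfloor>X / n powr t\<rfloor>"] assms floor_last_eq_0
    by simp
qed

lemma card_floor_values_integer:
  assumes "2 \<le> X" "turning_point t X = real_of_int M"
  shows "int (card (floor_values t X)) = M + \<lfloor>X / M powr t\<rfloor>"
proof (rule card_floor_values)
  show "1 \<le> M" "M \<le> X"
    using assms turning_point_gt_1 turning_point_less by auto
  show "\<lfloor>X / (n + 1) powr t\<rfloor> < \<lfloor>X / n powr t\<rfloor>" if "1 \<le> n" "n < M" for n :: int
    by (rule floor_falls_before_turning_point) (use that assms in linarith)+
  show "\<lfloor>X / (n + 1) powr t\<rfloor> \<le> \<lfloor>X / n powr t\<rfloor> \<and> \<lfloor>X / n powr t\<rfloor> \<le> \<lfloor>X / (n + 1) powr t\<rfloor> + 1"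
    if "M \<le> n" "n < X" for n :: int
    by (rule floor_unit_steps_after_turning_point) (use that assms in linarith)
qed (rule assms)

text \<open>
  An integer \<open>k\<close> satisfies \<open>k \<le> y\<close> iff \<open>k \<le> \<lfloor>y\<rfloor>\<close>; with \<open>y = X / \<lfloor>a + 1\<rfloor>\<^sup>t\<close> the test in
  \<open>correction\<close> thus asks whether the step across the turning point is not a strict fall.
\<close>

lemma correction_eq:
  defines "N \<equiv> \<lfloor>turning_point t X\<rfloor>"
  shows "correction t X = (if \<lfloor>X / (N + 1) powr t\<rfloor> < \<lfloor>X / N powr t\<rfloor> then 1 else 0)"
proof -
  have "1 \<le> N"
    using turning_point_gt_1 by (simp add: N_def le_floor_iff)
  then have "real_of_int k * (N + 1) powr t \<le> X \<longleftrightarrow> k \<le> \<lfloor>X / (N + 1) powr t\<rfloor>" for k :: int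
    by (simp add: le_floor_iff le_divide_eq)
  then show ?thesis
    by (auto simp: correction_def N_def)
qed

lemma card_floor_values_correction:
  defines "N \<equiv> \<lfloor>turning_point t X\<rfloor>"
  assumes "2 \<le> X"
  shows "int (card (floor_values t X)) = N + \<lfloor>X / (N + 1) powr t\<rfloor> + correction t X"
proof -
  have N: "1 \<le> N" "N < X" "N \<le> turning_point t X" "turning_point t X < N + 1"
    using turning_point_gt_1 turning_point_less[OF \<open>2 \<le> X\<close>]
    by (auto simp: N_def le_floor_iff floor_less_iff)
  have before: "\<lfloor>X / (n + 1) powr t\<rfloor> < \<lfloor>X / n powr t\<rfloor>" if "1 \<le> n" "n < N" for n :: int
    by (rule floor_falls_before_turning_point) (use that N in linarith)+
  have after: "\<lfloor>X / (n + 1) powr t\<rfloor> \<le> \<lfloor>X / n powr t\<rfloor> \<and>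
      \<lfloor>X / n powr t\<rfloor> \<le> \<lfloor>X / (n + 1) powr t\<rfloor> + 1" if "N + 1 \<le> n" for n :: int
    by (rule floor_unit_steps_after_turning_point) (use that N in linarith)
  show ?thesis
  proof (cases "\<lfloor>X / (N + 1) powr t\<rfloor> < \<lfloor>X / N powr t\<rfloor>")
    case True
    have "int (card (floor_values t X)) = (N + 1) + \<lfloor>X / (N + 1 :: int) powr t\<rfloor>"
    proof (rule card_floor_values)
      show "\<lfloor>X / (n + 1) powr t\<rfloor> < \<lfloor>X / n powr t\<rfloor>" if "1 \<le> n" "n < N + 1" for n :: int
        using that before[of n] True by (cases "n = N") auto
    qed (use N assms after in auto)
    then show ?thesis
      using True by (simp add: correction_eq flip: N_def)
  next
    case False
    have "X / (N + 1) powr t \<le> X / N powr t"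
      using N X t by (intro divide_left_mono powr_mono2) auto
    then have eq: "\<lfloor>X / N powr t\<rfloor> = \<lfloor>X / (N + 1) powr t\<rfloor>"
      using False floor_mono by (meson order.antisym not_less)
    have "int (card (floor_values t X)) = N + \<lfloor>X / N powr t\<rfloor>"
    proof (rule card_floor_values)
      show "\<lfloor>X / (n + 1) powr t\<rfloor> \<le> \<lfloor>X / n powr t\<rfloor> \<and> \<lfloor>X / n powr t\<rfloor> \<le> \<lfloor>X / (n + 1) powr t\<rfloor> + 1"
        if "N \<le> n" "n < X" for n :: int
        using that after[of n] eq by (cases "n = N") auto
    qed (use N assms before in auto)
    then show ?thesis
      using False eq by (simp add: correction_eq flip: N_def)
  qed
qed

end

theorem theorem1:
  fixes X :: int and t :: real
  assumes "X \<ge> 1" and "t > 1"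
  shows "(X = 1 \<longrightarrow> card (floor_values t X) = 1) \<and>
    (X \<ge> 2 \<longrightarrow>
      real (card (floor_values t X)) =
        (if turning_point t X \<in> \<int>
         then turning_point t X + real_of_int \<lfloor>real_of_int X / turning_point t X powr t\<rfloor>
         else real_of_int \<lfloor>turning_point t X\<rfloor>
              + real_of_int \<lfloor>real_of_int X / real_of_int \<lfloor>turning_point t X + 1\<rfloor> powr t\<rfloor>
              + real_of_int (correction t X)))"
proof (intro conjI impI)
  assume "X = 1"
  then have "floor_values t X = {1}"
    by (force simp: floor_values_def)
  then show "card (floor_values t X) = 1"
    by simp
next
  assume "X \<ge> 2"
  show "real (card (floor_values t X)) =
        (if turning_point t X \<in> \<int>
         then turning_point t X + real_of_int \<lfloor>real_of_int X / turning_point t X powr t\<rfloor>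
         else real_of_int \<lfloor>turning_point t X\<rfloor>
              + real_of_int \<lfloor>real_of_int X / real_of_int \<lfloor>turning_point t X + 1\<rfloor> powr t\<rfloor>
              + real_of_int (correction t X))"
  proof (cases "turning_point t X \<in> \<int>")
    case True
    then obtain M where "turning_point t X = real_of_int M"
      by (auto elim: Ints_cases)
    then show ?thesis
      using card_floor_values_integer[OF assms \<open>X \<ge> 2\<close>, of M]
      by (metis True of_int_add of_int_of_nat_eq)
  next
    case False
    have "real (card (floor_values t X)) = real_of_int (int (card (floor_values t X)))"
      by simp
    then show ?thesis
      using False unfolding card_floor_values_correction[OF assms \<open>X \<ge> 2\<close>] by simp
  qed
qed

end
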